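(* There exists a computable coloring $c:\mathbf{N}\to\{0,1\}$ such that, for every infinite apart set $H$ of positive integers, if there are integers $a,b>0$ such that $FS^{\{a,\,a+b,\,a+2b,\,b\}}(H)$ is monochromatic under $c$, then $K$ is computable from $H$ (i.e. $K\leq_T H$), where $K=\emptyset'$ is the halting set.
   Context: $\mathbf{N}$ is the set of natural numbers. For a positive integer $n=2^{t_1}+\dots+2^{t_k}$ with $t_1<\dots<t_k$ let $\lambda(n)=t_1$ and $\mu(n)=t_k$. A set $X$ of positive integers is apart (satisfies the Apartness Condition) if for all $x,x'\in X$ with $x<x'$ we have $\mu(x)<\lambda(x')$. For a set $A$ of positive integers and a set $B\subseteq\mathbf{N}$, $FS^{A}(B)$ denotes the set of all sums of exactly $j$ distinct elements of $B$, for all $j\in A$. A set is monochromatic under $c$ if $c$ is constant on it. $\leq_T$ denotes Turing reducibility; $K$ denotes the (computably enumerable, non-computable) halting set, equivalently the Turing jump $\emptyset'$ of the empty set. *)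

theory Defs
  imports Main "HOL-Library.Nat_Bijection"
begin

text \<open>
  Partial recursive functions relative to a set, presented with unary functions and the pairing
  bijection \<^const>\<open>prod_encode\<close> in place of functions of several arguments. The identity is
  \<open>Pairing First Second\<close>.
\<close>

datatype prog =
    Zero
  | Succ
  | First
  | Second
  | Query
  | Pairing prog prog
  | Comp prog prog
  | Prec prog prog
  | Mini prog

text \<open>
  Below, \<open>None\<close> means divergence. Minimisation requires all values before the first zero to be
  defined.
\<close>

primrec eval :: "nat set \<Rightarrow> prog \<Rightarrow> nat \<Rightarrow> nat option" where
  "eval A Zero n = Some 0"
| "eval A Succ n = Some (Suc n)"
| "eval A First n = Some (fst (prod_decode n))"
| "eval A Second n = Some (snd (prod_decode n))"
| "eval A Query n = Some (if n \<in> A then 1 else 0)"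
| "eval A (Pairing p q) n =
     Option.bind (eval A p n) (\<lambda>x. Option.bind (eval A q n) (\<lambda>y. Some (prod_encode (x, y))))"
| "eval A (Comp p q) n = Option.bind (eval A q n) (eval A p)"
| "eval A (Prec p q) n =
     (let a = fst (prod_decode n)
      in rec_nat (eval A p a)
           (\<lambda>k r. Option.bind r (\<lambda>v. eval A q (prod_encode (a, prod_encode (k, v)))))
           (snd (prod_decode n)))"
| "eval A (Mini p) n =
     (if \<exists>k. eval A p (prod_encode (n, k)) = Some 0 \<and>
             (\<forall>j<k. eval A p (prod_encode (n, j)) \<noteq> None)
      then Some (LEAST k. eval A p (prod_encode (n, k)) = Some 0)
      else None)"

definition computable_in :: "nat set \<Rightarrow> (nat \<Rightarrow> nat) \<Rightarrow> bool" where
  "computable_in A f \<longleftrightarrow> (\<exists>p. \<forall>n. eval A p n = Some (f n))"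

text \<open>For the empty set \<open>Query\<close> behaves as \<open>Zero\<close>, so this is plain computability.\<close>

definition computable :: "(nat \<Rightarrow> nat) \<Rightarrow> bool" where
  "computable f \<longleftrightarrow> computable_in {} f"

definition turing_reducible :: "nat set \<Rightarrow> nat set \<Rightarrow> bool"  (infix \<open>\<le>\<^sub>T\<close> 50) where
  "B \<le>\<^sub>T A \<longleftrightarrow> computable_in A (\<lambda>n. if n \<in> B then 1 else 0)"

text \<open>An effective numbering of the programs; it is a bijection (lemma \<open>bij_code\<close> below).\<close>

primrec code :: "prog \<Rightarrow> nat" where
  "code Zero = 0"
| "code Succ = 1"
| "code First = 2"
| "code Second = 3"
| "code Query = 4"
| "code (Pairing p q) = 5 + 4 * prod_encode (code p, code q)"
| "code (Comp p q) = 6 + 4 * prod_encode (code p, code q)"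
| "code (Prec p q) = 7 + 4 * prod_encode (code p, code q)"
| "code (Mini p) = 8 + 4 * code p"

lemma inj_code: "inj code"
proof (rule injI)
  fix p q :: prog
  show "code p = code q \<Longrightarrow> p = q"
  proof (induction p arbitrary: q)
    case Zero then show ?case by (cases q) auto
  next
    case Succ then show ?case by (cases q) auto
  next
    case First then show ?case by (cases q) auto
  next
    case Second then show ?case by (cases q) auto
  next
    case Query then show ?case by (cases q) auto
  next
    case (Pairing p1 p2) then show ?case by (cases q) (auto, presburger+)
  next
    case (Comp p1 p2) then show ?case by (cases q) (auto, presburger+)
  next
    case (Prec p1 p2) then show ?case by (cases q) (auto, presburger+)
  next
    case (Mini p) then show ?case by (cases q) (auto, presburger+)
  qed
qed

lemma ex_code: "\<exists>p. code p = n"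
proof (induction n rule: less_induct)
  case (less n)
  show ?case
  proof (cases "n < 5")
    case True
    then have "n = 0 \<or> n = 1 \<or> n = 2 \<or> n = 3 \<or> n = 4" by auto
    then show ?thesis
      using code.simps(1-5) by metis
  next
    case False
    define m where "m = (n - 5) div 4"
    have split: "n = 5 + 4 * m \<or> n = 6 + 4 * m \<or> n = 7 + 4 * m \<or> n = 8 + 4 * m"
      using False unfolding m_def by presburger
    then have "m < n" by auto
    obtain x y where xy: "m = prod_encode (x, y)"
      by (metis prod_decode_inverse surj_pair)
    have "x < n" "y < n"
      using le_prod_encode_1[of x y] le_prod_encode_2[of y x] \<open>m < n\<close> xy by auto
    then obtain p q r where "code p = x" "code q = y" "code r = m"
      using less \<open>m < n\<close> by metis
    then show ?thesis
      using split code.simps(6-9) xy by metis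
  qed
qed

lemma bij_code: "bij code"
  using inj_code ex_code by (metis bijI surj_def)

definition jump :: "nat set \<Rightarrow> nat set" where
  "jump A = {code p |p. eval A p (code p) \<noteq> None}"

definition halting_set :: "nat set" where
  "halting_set = jump {}"

definition exponents :: "nat \<Rightarrow> nat set" where
  "exponents n = {t. bit n t}"

lemma finite_exponents: "finite (exponents n)"
proof (rule finite_subset)
  show "exponents n \<subseteq> {..<n}"
  proof
    fix t assume "t \<in> exponents n"
    then have "n div 2 ^ t \<noteq> 0"
      unfolding exponents_def bit_iff_odd by (metis even_zero mem_Collect_eq)
    then have "2 ^ t \<le> n" by (metis div_less not_le)
    moreover have "t < 2 ^ t" by (rule less_exp)
    ultimately show "t \<in> {..<n}" by (simp only: lessThan_iff)
  qed
qed simp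

lemma sum_exponents: "(\<Sum>t\<in>exponents n. 2 ^ t) = n"
proof (induction n rule: less_induct)
  case (less n)
  show ?case
  proof (cases "n = 0")
    case True
    then show ?thesis by (simp add: exponents_def)
  next
    case False
    have split: "exponents n = (if odd n then {0} else {}) \<union> Suc ` exponents (n div 2)"
    proof (rule set_eqI)
      fix t
      show "t \<in> exponents n \<longleftrightarrow> t \<in> (if odd n then {0} else {}) \<union> Suc ` exponents (n div 2)"
        by (cases t) (auto simp: exponents_def bit_0 bit_Suc)
    qed
    have "(\<Sum>t\<in>exponents n. 2 ^ t) =
        (\<Sum>t\<in>(if odd n then {0} else {}). 2 ^ t) + (\<Sum>t\<in>Suc ` exponents (n div 2). (2::nat) ^ t)"
      unfolding split by (rule sum.union_disjoint) (auto simp: finite_exponents)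
    also have "(\<Sum>t\<in>Suc ` exponents (n div 2). (2::nat) ^ t) = 2 * (\<Sum>t\<in>exponents (n div 2). 2 ^ t)"
      by (simp add: sum.reindex sum_distrib_left)
    also have "(\<Sum>t\<in>exponents (n div 2). 2 ^ t) = n div 2"
      using False by (intro less) simp
    finally show ?thesis by (cases "odd n") auto
  qed
qed

definition lowest_exponent :: "nat \<Rightarrow> nat" where
  "lowest_exponent n = Min (exponents n)"

definition highest_exponent :: "nat \<Rightarrow> nat" where
  "highest_exponent n = Max (exponents n)"

definition apart :: "nat set \<Rightarrow> bool" where
  "apart X \<longleftrightarrow> (\<forall>x\<in>X. \<forall>x'\<in>X. x < x' \<longrightarrow> highest_exponent x < lowest_exponent x')"

definition FS :: "nat set \<Rightarrow> nat set \<Rightarrow> nat set" where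
  "FS A B = {\<Sum>F |F. F \<subseteq> B \<and> finite F \<and> card F \<in> A}"

definition monochromatic :: "(nat \<Rightarrow> 'c) \<Rightarrow> nat set \<Rightarrow> bool" where
  "monochromatic c S \<longleftrightarrow> (\<forall>x\<in>S. \<forall>y\<in>S. c x = c y)"

end

theory Submission imports Defs begin

text \<open>
  Let \<open>K r\<close> be the part of the halting set enumerated within \<open>r\<close> steps. Call a pair \<open>t < s\<close> of
  consecutive binary exponents of \<open>n\<close> short if some \<open>x \<le> t\<close> enters \<open>K\<close> after stage \<open>s\<close>, and
  very short if this is visible by the stage given by some exponent of \<open>n\<close>. The color of \<open>n\<close> is the
  parity of its number of very short gaps. If \<open>m\<close> lies far beyond \<open>n\<close>, then the very short gaps of
  \<open>n + m\<close> are the short gaps of \<open>n\<close> and the very short gaps of \<open>m\<close>; so on a monochromatic set, sums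
  of \<open>a\<close> or \<open>a + b\<close> elements of \<open>H\<close> have an even number of short gaps. Comparing \<open>n\<close>, \<open>m\<close> and
  \<open>n + m\<close> for \<open>n < m\<close>, sums of \<open>a\<close> and \<open>b\<close> elements respectively, the gap between them is short iff
  \<open>m\<close> has an odd number of short gaps. This criterion does not involve \<open>n\<close>, and for a fixed \<open>n\<close> the
  gap is not short once \<open>m\<close> is large. Hence no gap between two consecutive large elements of \<open>H\<close> is
  short, and \<open>H\<close> computes a stage at which \<open>K\<close> has settled up to a given number.
\<close>

section \<open>Closure properties of computability\<close>

abbreviation p1 :: "nat \<Rightarrow> nat" where "p1 n \<equiv> fst (prod_decode n)"
abbreviation p2 :: "nat \<Rightarrow> nat" where "p2 n \<equiv> snd (prod_decode n)"

definition decidable_in :: "nat set \<Rightarrow> (nat \<Rightarrow> bool) \<Rightarrow> bool" where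
  "decidable_in A P \<longleftrightarrow> computable_in A (\<lambda>n. if P n then 1 else 0)"

named_theorems computable_intros

text \<open>Kept out of \<open>computable_intros\<close>: as an introduction rule it would match
  every \<open>computable_in\<close> goal.\<close>

lemma computable_in_comp:
  assumes "computable_in A f" "computable_in A g"
  shows "computable_in A (\<lambda>n. f (g n))"
proof -
  obtain p q where "\<forall>n. eval A p n = Some (f n)" "\<forall>n. eval A q n = Some (g n)"
    using assms unfolding computable_in_def by blast
  then have "\<forall>n. eval A (Comp p q) n = Some (f (g n))" by simp
  then show ?thesis unfolding computable_in_def by blast
qed

lemma computable_in_id [computable_intros]: "computable_in A (\<lambda>n. n)"
proof -
  have "\<forall>n. eval A (Pairing First Second) n = Some n" by simp
  then show ?thesis unfolding computable_in_def by blast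
qed

lemma computable_in_Suc [computable_intros]:
  assumes "computable_in A f"
  shows "computable_in A (\<lambda>n. Suc (f n))"
proof -
  have "computable_in A Suc" unfolding computable_in_def by (rule exI[of _ Succ]) simp
  then show ?thesis by (rule computable_in_comp[OF _ assms])
qed

lemma computable_in_p1 [computable_intros]:
  assumes "computable_in A f"
  shows "computable_in A (\<lambda>n. p1 (f n))"
proof -
  have "computable_in A p1" unfolding computable_in_def by (rule exI[of _ First]) simp
  then show ?thesis by (rule computable_in_comp[OF _ assms])
qed

lemma computable_in_p2 [computable_intros]:
  assumes "computable_in A f"
  shows "computable_in A (\<lambda>n. p2 (f n))"
proof -
  have "computable_in A p2" unfolding computable_in_def by (rule exI[of _ Second]) simp
  then show ?thesis by (rule computable_in_comp[OF _ assms])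
qed

lemma computable_in_prod_encode [computable_intros]:
  assumes "computable_in A f" "computable_in A g"
  shows "computable_in A (\<lambda>n. prod_encode (f n, g n))"
proof -
  obtain p q where "\<forall>n. eval A p n = Some (f n)" "\<forall>n. eval A q n = Some (g n)"
    using assms unfolding computable_in_def by blast
  then have "\<forall>n. eval A (Pairing p q) n = Some (prod_encode (f n, g n))" by simp
  then show ?thesis unfolding computable_in_def by blast
qed

lemma computable_in_const [computable_intros]: "computable_in A (\<lambda>n. c)"
proof (induction c)
  case 0
  show ?case unfolding computable_in_def by (rule exI[of _ Zero]) simp
qed (rule computable_in_Suc)

lemma computable_in_rec_nat [computable_intros]:
  assumes "computable_in A b" "computable_in A (\<lambda>z. s (p1 z) (p1 (p2 z)) (p2 (p2 z)))"
    and "computable_in A g"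
  shows "computable_in A (\<lambda>n. rec_nat (b n) (\<lambda>k v. s n k v) (g n))"
proof -
  obtain p q r where *: "\<And>n. eval A p n = Some (b n)"
      "\<And>z. eval A q z = Some (s (p1 z) (p1 (p2 z)) (p2 (p2 z)))" "\<And>n. eval A r n = Some (g n)"
    using assms unfolding computable_in_def by blast
  have "rec_nat (eval A p n)
      (\<lambda>k r. Option.bind r (\<lambda>v. eval A q (prod_encode (n, prod_encode (k, v))))) m
    = Some (rec_nat (b n) (\<lambda>k v. s n k v) m)" for n m
    by (induction m) (simp_all add: *)
  \<comment> \<open>\<open>Prec\<close> expects a parameter paired with the number of rounds. The
    whole input \<open>n\<close> serves as parameter, so that \<open>b\<close> and \<open>s\<close>
    may depend on it.\<close>
  then have "\<forall>n. eval A (Comp (Prec p q) (Pairing (Pairing First Second) r)) n =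
      Some (rec_nat (b n) (\<lambda>k v. s n k v) (g n))"
    by (simp add: *)
  then show ?thesis unfolding computable_in_def by blast
qed

lemma computable_in_Least [computable_intros]:
  assumes "decidable_in A (\<lambda>z. P (p1 z) (p2 z))" "\<And>n. \<exists>k. P n k"
  shows "computable_in A (\<lambda>n. LEAST k. P n k)"
proof -
  \<comment> \<open>\<open>Mini\<close> looks for a zero, so the truth value is flipped: zero rounds
    leave 1, one round gives 0.\<close>
  have "computable_in A (\<lambda>z. rec_nat 1 (\<lambda>_ _. 0) (if P (p1 z) (p2 z) then 1 else 0))"
    using assms(1) unfolding decidable_in_def by (intro computable_intros)
  moreover have "(\<lambda>z. rec_nat 1 (\<lambda>_ _. 0) (if P (p1 z) (p2 z) then 1 else 0)) =
      (\<lambda>z. if P (p1 z) (p2 z) then 0 else (1::nat))"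
    by auto
  ultimately have "computable_in A (\<lambda>z. if P (p1 z) (p2 z) then 0 else 1)"
    by (rule subst[rotated])
  then obtain p where p: "\<And>z. eval A p z = Some (if P (p1 z) (p2 z) then 0 else 1)"
    unfolding computable_in_def by blast
  have "\<forall>n. eval A (Mini p) n = Some (LEAST k. P n k)"
    using assms(2) by (simp add: p)
  then show ?thesis unfolding computable_in_def by blast
qed

lemma computable_in_if [computable_intros]:
  assumes "decidable_in A P" "computable_in A f" "computable_in A g"
  shows "computable_in A (\<lambda>n. if P n then f n else g n)"
proof -
  \<comment> \<open>Zero rounds return \<open>g n\<close>, one round returns
    \<open>f n\<close>.\<close>
  have "computable_in A (\<lambda>n. rec_nat (g n) (\<lambda>_ _. f n) (if P n then 1 else 0))"
    using assms(1) unfolding decidable_in_def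
    by (intro computable_intros computable_in_comp[OF assms(2)] assms(3))
  moreover have "(\<lambda>n. rec_nat (g n) (\<lambda>_ _. f n) (if P n then 1 else 0)) =
      (\<lambda>n. if P n then f n else g n)"
    by auto
  ultimately show ?thesis by simp
qed

lemma computable_in_diff [computable_intros]:
  assumes "computable_in A f" "computable_in A g"
  shows "computable_in A (\<lambda>n. f n - g n)"
proof -
  \<comment> \<open>The inner recursion is the predecessor function.\<close>
  have "computable_in A (\<lambda>n. rec_nat (f n) (\<lambda>_ v. rec_nat 0 (\<lambda>k _. k) v) (g n))"
    using assms by (intro computable_intros)
  moreover have "rec_nat a (\<lambda>_ v. rec_nat 0 (\<lambda>k _. k) v) b = a - b" for a b :: nat
  proof (induction b)
    case (Suc b)
    then show ?case by (cases "a - b") auto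
  qed simp
  ultimately show ?thesis by simp
qed

lemma computable_in_add [computable_intros]:
  assumes "computable_in A f" "computable_in A g"
  shows "computable_in A (\<lambda>n. f n + g n)"
proof -
  have "computable_in A (\<lambda>n. rec_nat (f n) (\<lambda>_ v. Suc v) (g n))"
    using assms by (intro computable_intros)
  moreover have "rec_nat a (\<lambda>_ v. Suc v) b = a + b" for a b
    by (induction b) auto
  ultimately show ?thesis by simp
qed

lemma computable_in_power2 [computable_intros]:
  assumes "computable_in A f"
  shows "computable_in A (\<lambda>n. 2 ^ f n)"
proof -
  have "computable_in A (\<lambda>n. rec_nat 1 (\<lambda>_ v. v + v) (f n))"
    using assms by (intro computable_intros)
  moreover have "rec_nat (1::nat) (\<lambda>_ v. v + v) a = 2 ^ a" for a
    by (induction a) auto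
  ultimately show ?thesis by simp
qed

lemma computable_in_div2 [computable_intros]:
  assumes "computable_in A f"
  shows "computable_in A (\<lambda>n. f n div 2)"
proof -
  \<comment> \<open>This rests on \<open>Suc k div 2 = k - k div 2\<close>.\<close>
  have "computable_in A (\<lambda>n. rec_nat 0 (\<lambda>k v. k - v) (f n))"
    using assms by (intro computable_intros)
  moreover have "rec_nat 0 (\<lambda>k v. k - v) a = a div 2" for a
    by (induction a) auto
  ultimately show ?thesis by simp
qed

lemma computable_in_mod2 [computable_intros]:
  assumes "computable_in A f"
  shows "computable_in A (\<lambda>n. f n mod 2)"
proof -
  have "computable_in A (\<lambda>n. rec_nat 0 (\<lambda>_ v. 1 - v) (f n))"
    using assms by (intro computable_intros)
  moreover have "rec_nat 0 (\<lambda>_ v. 1 - v) a = a mod 2" for a :: nat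
    by (induction a) (auto simp: mod_Suc)
  ultimately show ?thesis by simp
qed

lemma computable_in_sum [computable_intros]:
  assumes "computable_in A (\<lambda>z. f (p1 z) (p2 z))" "computable_in A g"
  shows "computable_in A (\<lambda>n. \<Sum>k<g n. f n k)"
proof -
  \<comment> \<open>The recursion step receives \<open>n\<close>, \<open>k\<close> and the partial
    sum, whereas the hypothesis on \<open>f\<close> is about pairs of \<open>n\<close> and
    \<open>k\<close>.\<close>
  have "computable_in A (\<lambda>z. f (p1 z) (p1 (p2 z)))"
    using computable_in_comp[OF assms(1), of "\<lambda>z. prod_encode (p1 z, p1 (p2 z))"]
    by (simp add: computable_intros)
  then have "computable_in A (\<lambda>n. rec_nat 0 (\<lambda>k v. v + f n k) (g n))"
    by (intro computable_intros assms(2))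
  moreover have "rec_nat 0 (\<lambda>k v. v + f n k) m = (\<Sum>k<m. f n k)" for n m
    by (induction m) auto
  ultimately show ?thesis by simp
qed

lemma decidable_in_le [computable_intros]:
  assumes "computable_in A f" "computable_in A g"
  shows "decidable_in A (\<lambda>n. f n \<le> g n)"
proof -
  have "computable_in A (\<lambda>n. 1 - (f n - g n))"
    using assms by (intro computable_intros)
  moreover have "1 - (a - b) = (if a \<le> b then 1 else 0)" for a b :: nat
    by auto
  ultimately show ?thesis by (simp add: decidable_in_def)
qed

lemma decidable_in_less [computable_intros]:
  assumes "computable_in A f" "computable_in A g"
  shows "decidable_in A (\<lambda>n. f n < g n)"
  unfolding less_eq_Suc_le using assms by (intro computable_intros)

lemma decidable_in_conj [computable_intros]:
  assumes "decidable_in A P" "decidable_in A Q"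
  shows "decidable_in A (\<lambda>n. P n \<and> Q n)"
proof -
  have "computable_in A (\<lambda>n. if P n then if Q n then 1 else 0 else 0)"
    using assms by (intro computable_intros)
  moreover have "(if p then if q then 1 else 0 else 0) = (if p \<and> q then 1 else (0::nat))" for p q
    by simp
  ultimately show ?thesis by (simp add: decidable_in_def)
qed

lemma decidable_in_not [computable_intros]:
  assumes "decidable_in A P"
  shows "decidable_in A (\<lambda>n. \<not> P n)"
proof -
  have "computable_in A (\<lambda>n. if P n then 0 else 1)"
    using assms by (intro computable_intros)
  moreover have "(if p then 0 else 1) = (if \<not> p then 1 else (0::nat))" for p
    by simp
  ultimately show ?thesis by (simp add: decidable_in_def)
qed

lemma decidable_in_eq [computable_intros]:
  fixes f g :: "nat \<Rightarrow> nat"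
  assumes "computable_in A f" "computable_in A g"
  shows "decidable_in A (\<lambda>n. f n = g n)"
  unfolding eq_iff using assms by (intro computable_intros)

lemma decidable_in_Ex_less [computable_intros]:
  assumes "decidable_in A (\<lambda>z. P (p1 z) (p2 z))" "computable_in A g"
  shows "decidable_in A (\<lambda>n. \<exists>k<g n. P n k)"
proof -
  have "decidable_in A (\<lambda>n. 0 < (\<Sum>k<g n. if P n k then 1 else (0::nat)))"
    using assms by (intro computable_intros)
  moreover have "0 < (\<Sum>k<m. if P n k then 1 else (0::nat)) \<longleftrightarrow> (\<exists>k<m. P n k)" for n m
    by (auto simp: sum_eq_0_iff simp flip: neq0_conv)
  ultimately show ?thesis by simp
qed

lemma decidable_in_bit [computable_intros]:
  assumes "computable_in A f" "computable_in A g"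
  shows "decidable_in A (\<lambda>n. bit (f n) (g n))"
proof -
  have "computable_in A (\<lambda>n. rec_nat (f n) (\<lambda>_ v. v div 2) (g n))"
    using assms by (intro computable_intros)
  moreover have "rec_nat a (\<lambda>_ v. v div 2) b = a div 2 ^ b" for a b :: nat
    by (induction b) (auto simp: mult.commute simp flip: div_mult2_eq)
  ultimately have "decidable_in A (\<lambda>n. (f n div 2 ^ g n) mod 2 = 1)"
    by (intro computable_intros) simp
  then show ?thesis by (simp add: bit_iff_odd odd_iff_mod_2_eq_one)
qed

text \<open>The only closure rule that consults the oracle.\<close>

lemma decidable_in_mem [computable_intros]:
  assumes "computable_in A f"
  shows "decidable_in A (\<lambda>n. f n \<in> A)"
proof -
  have "computable_in A (\<lambda>n. if n \<in> A then 1 else 0)"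
    unfolding computable_in_def by (rule exI[of _ Query]) simp
  then show ?thesis unfolding decidable_in_def by (rule computable_in_comp[OF _ assms])
qed

section \<open>A stack machine for the programs\<close>

text \<open>The machine serves to make halting within a given number of steps decidable: one step is
  a computable function on numbers. \<open>Suc\<close> separates nonempty stacks from
  \<open>0\<close>, the empty one.\<close>

definition push :: "nat \<Rightarrow> nat \<Rightarrow> nat" where
  "push f R = Suc (prod_encode (f, R))"

text \<open>
  Stack frames, acting on the current value \<open>v\<close>: \<open>pairL c n\<close> keeps \<open>v\<close> as first component and
  runs \<open>c\<close> on \<open>n\<close> for the second one, \<open>pairR x\<close> forms the pair of \<open>x\<close> and \<open>v\<close>, \<open>loop c a k m\<close> has
  \<open>v\<close> as result of \<open>k\<close> out of \<open>m\<close> rounds of a primitive recursion, and \<open>search c n k\<close> has \<open>v\<close> as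
  result of testing the candidate \<open>k\<close> of a minimisation.
\<close>

abbreviation run :: "nat \<Rightarrow> nat" where "run c \<equiv> prod_encode (0, c)"
abbreviation pairL :: "nat \<Rightarrow> nat \<Rightarrow> nat" where
  "pairL c n \<equiv> prod_encode (2, prod_encode (c, n))"
abbreviation pairR :: "nat \<Rightarrow> nat" where "pairR x \<equiv> prod_encode (3, x)"
abbreviation loop :: "nat \<Rightarrow> nat \<Rightarrow> nat \<Rightarrow> nat \<Rightarrow> nat" where
  "loop c a k m \<equiv> prod_encode (4, prod_encode (c, prod_encode (a, prod_encode (k, m))))"
abbreviation search :: "nat \<Rightarrow> nat \<Rightarrow> nat \<Rightarrow> nat" where
  "search c n k \<equiv> prod_encode (5, prod_encode (c, prod_encode (n, k)))"

text \<open>Compound programs have codes \<open>5 + 4 * m\<close> to \<open>8 + 4 * m\<close>.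
  Halving \<open>c - 5\<close> twice yields the constructor from the two remainders and
  \<open>m\<close> as quotient, using only operations already known to be computable. Code 4 is
  \<open>Query\<close>, which answers 0 for the empty oracle.\<close>

definition run_step :: "nat \<Rightarrow> nat \<Rightarrow> nat \<Rightarrow> nat" where
  "run_step c v R =
    (if c = 0 then prod_encode (0, R)
     else if c = 1 then prod_encode (Suc v, R)
     else if c = 2 then prod_encode (p1 v, R)
     else if c = 3 then prod_encode (p2 v, R)
     else if c = 4 then prod_encode (0, R)
     else let m = (c - 5) div 2 div 2 in
       if (c - 5) mod 2 = 0 then
         if (c - 5) div 2 mod 2 = 0
         then prod_encode (v, push (run (p1 m)) (push (pairL (p2 m) v) R))
         else prod_encode (p1 v, push (run (p1 m)) (push (loop (p2 m) (p1 v) 0 (p2 v)) R))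
       else
         if (c - 5) div 2 mod 2 = 0
         then prod_encode (v, push (run (p2 m)) (push (run (p1 m)) R))
         else prod_encode (prod_encode (v, 0), push (run m) (push (search m v 0) R)))"

definition frame_step :: "nat \<Rightarrow> nat \<Rightarrow> nat \<Rightarrow> nat \<Rightarrow> nat" where
  "frame_step t d v R =
    (if t = 0 then run_step d v R
     else if t = 2 then prod_encode (p2 d, push (run (p1 d)) (push (pairR v) R))
     else if t = 3 then prod_encode (prod_encode (d, v), R)
     else if t = 4 then
       let c = p1 d; a = p1 (p2 d); k = p1 (p2 (p2 d)); m = p2 (p2 (p2 d)) in
       if k = m then prod_encode (v, R)
       else prod_encode (prod_encode (a, prod_encode (k, v)),
         push (run c) (push (loop c a (Suc k) m) R))
     else
       let c = p1 d; n = p1 (p2 d); k = p2 (p2 d) in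
       if v = 0 then prod_encode (k, R)
       else prod_encode (prod_encode (n, Suc k), push (run c) (push (search c n (Suc k)) R)))"

text \<open>A state is a pair of the current value and the stack; the state is final if the stack is \<open>0\<close>.\<close>

definition step :: "nat \<Rightarrow> nat" where
  "step s = (if p2 s = 0 then s
     else frame_step (p1 (p1 (p2 s - 1))) (p2 (p1 (p2 s - 1))) (p1 s) (p2 (p2 s - 1)))"

definition halts_within :: "nat \<Rightarrow> nat \<Rightarrow> bool" where
  "halts_within r s \<longleftrightarrow> p2 ((step ^^ r) s) = 0"

lemma computable_in_push [computable_intros]:
  assumes "computable_in A f" "computable_in A g"
  shows "computable_in A (\<lambda>n. push (f n) (g n))"
  unfolding push_def using assms by (intro computable_intros)

lemma computable_in_run_step [computable_intros]:
  assumes "computable_in A f" "computable_in A g" "computable_in A h"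
  shows "computable_in A (\<lambda>n. run_step (f n) (g n) (h n))"
  unfolding run_step_def Let_def using assms by (intro computable_intros)

lemma computable_in_frame_step [computable_intros]:
  assumes "computable_in A e" "computable_in A f" "computable_in A g" "computable_in A h"
  shows "computable_in A (\<lambda>n. frame_step (e n) (f n) (g n) (h n))"
  unfolding frame_step_def Let_def using assms by (intro computable_intros)

lemma computable_in_step [computable_intros]:
  assumes "computable_in A f"
  shows "computable_in A (\<lambda>n. step (f n))"
  unfolding step_def using assms by (intro computable_intros)

lemma decidable_in_halts_within [computable_intros]:
  assumes "computable_in A f" "computable_in A g"
  shows "decidable_in A (\<lambda>n. halts_within (f n) (g n))"
proof -
  have "computable_in A (\<lambda>n. rec_nat (g n) (\<lambda>_ v. step v) (f n))"
    using assms by (intro computable_intros)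
  moreover have "rec_nat s (\<lambda>_ v. step v) r = (step ^^ r) s" for r s
    by (induction r) auto
  ultimately show ?thesis unfolding halts_within_def by (intro computable_intros) simp
qed

lemma step_run: "step (prod_encode (v, push (run c) R)) = run_step c v R"
  by (simp add: step_def push_def frame_step_def)

lemma step_pairL:
  "step (prod_encode (v, push (pairL c n) R)) = prod_encode (n, push (run c) (push (pairR v) R))"
  by (simp add: step_def push_def frame_step_def)

lemma step_pairR: "step (prod_encode (v, push (pairR x) R)) = prod_encode (prod_encode (x, v), R)"
  by (simp add: step_def push_def frame_step_def)

lemma step_loop:
  "step (prod_encode (v, push (loop c a k m) R)) =
    (if k = m then prod_encode (v, R)
     else prod_encode (prod_encode (a, prod_encode (k, v)),
       push (run c) (push (loop c a (Suc k) m) R)))"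
  by (simp add: step_def push_def frame_step_def)

lemma step_search:
  "step (prod_encode (v, push (search c n k) R)) =
    (if v = 0 then prod_encode (k, R)
     else prod_encode (prod_encode (n, Suc k), push (run c) (push (search c n (Suc k)) R)))"
  by (simp add: step_def push_def frame_step_def)

lemma run_step_code:
  "run_step (code Zero) v R = prod_encode (0, R)"
  "run_step (code Succ) v R = prod_encode (Suc v, R)"
  "run_step (code First) v R = prod_encode (p1 v, R)"
  "run_step (code Second) v R = prod_encode (p2 v, R)"
  "run_step (code Query) v R = prod_encode (0, R)"
  "run_step (code (Pairing p q)) v R =
    prod_encode (v, push (run (code p)) (push (pairL (code q) v) R))"
  "run_step (code (Comp p q)) v R = prod_encode (v, push (run (code q)) (push (run (code p)) R))"
  "run_step (code (Prec p q)) v R =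
    prod_encode (p1 v, push (run (code p)) (push (loop (code q) (p1 v) 0 (p2 v)) R))"
  "run_step (code (Mini p)) v R =
    prod_encode (prod_encode (v, 0), push (run (code p)) (push (search (code p) v 0) R))"
proof -
  have *: "4 * m div 2 div 2 = m" "4 * m mod 2 = 0" "4 * m div 2 mod 2 = 0"
    "Suc (4 * m) div 2 div 2 = m" "Suc (4 * m) mod 2 = 1" "Suc (4 * m) div 2 mod 2 = 0"
    "Suc (Suc (4 * m)) div 2 div 2 = m" "Suc (Suc (4 * m)) mod 2 = 0"
    "Suc (Suc (4 * m)) div 2 mod 2 = 1"
    "Suc (Suc (Suc (4 * m))) div 2 div 2 = m" "Suc (Suc (Suc (4 * m))) mod 2 = 1"
    "Suc (Suc (Suc (4 * m))) div 2 mod 2 = 1" for m :: nat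
    by presburger+
  have diff: "5 + m - 5 = m" "6 + m - 5 = Suc m" "7 + m - 5 = Suc (Suc m)"
    "8 + m - 5 = Suc (Suc (Suc m))" for m :: nat
    by auto
  show "run_step (code (Pairing p q)) v R =
      prod_encode (v, push (run (code p)) (push (pairL (code q) v) R))"
    "run_step (code (Comp p q)) v R = prod_encode (v, push (run (code q)) (push (run (code p)) R))"
    "run_step (code (Prec p q)) v R =
      prod_encode (p1 v, push (run (code p)) (push (loop (code q) (p1 v) 0 (p2 v)) R))"
    "run_step (code (Mini p)) v R =
      prod_encode (prod_encode (v, 0), push (run (code p)) (push (search (code p) v 0) R))"
    by (simp_all only: run_step_def code.simps diff Let_def *) simp_all
qed (simp_all add: run_step_def)

lemmas step_simps = step_run step_pairL step_pairR step_loop step_search run_step_code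

section \<open>Correctness of the machine\<close>

definition reaches :: "nat \<Rightarrow> nat \<Rightarrow> bool" where
  "reaches s t \<longleftrightarrow> (\<exists>j. (step ^^ j) s = t)"

lemma reaches_refl: "reaches s s"
  unfolding reaches_def by (rule exI[of _ 0]) simp

lemma reaches_trans:
  assumes "reaches s t" "reaches t u"
  shows "reaches s u"
proof -
  obtain i j where "(step ^^ i) s = t" "(step ^^ j) t = u"
    using assms unfolding reaches_def by blast
  then have "(step ^^ (j + i)) s = u" by (simp add: funpow_add)
  then show ?thesis unfolding reaches_def by blast
qed

lemma reaches_step:
  assumes "reaches (step s) t"
  shows "reaches s t"
proof -
  obtain j where "(step ^^ j) (step s) = t"
    using assms unfolding reaches_def by blast
  then have "(step ^^ Suc j) s = t" by (simp add: funpow_swap1)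
  then show ?thesis unfolding reaches_def by blast
qed

lemma reaches_single: "step s = t \<Longrightarrow> reaches s t"
  by (rule reaches_step) (simp add: reaches_refl)

text \<open>Induction on the program. The stack \<open>R\<close> stays arbitrary because a
  subprogram runs on top of the frames left by its caller.\<close>

lemma reaches_eval:
  "eval {} p n = Some v \<Longrightarrow> reaches (prod_encode (n, push (run (code p)) R)) (prod_encode (v, R))"
proof (induction p arbitrary: n v R)
  case (Pairing p q)
  then obtain x y where xy: "eval {} p n = Some x" "eval {} q n = Some y" "v = prod_encode (x, y)"
    by (auto split: bind_splits)
  have "reaches (prod_encode (n, push (run (code p)) (push (pairL (code q) n) R)))
      (prod_encode (n, push (run (code q)) (push (pairR x) R)))"
    by (rule reaches_trans[OF Pairing.IH(1)[OF xy(1)]], rule reaches_step)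
      (simp add: step_simps reaches_refl)
  moreover have "reaches \<dots> (prod_encode (v, R))"
    by (rule reaches_trans[OF Pairing.IH(2)[OF xy(2)]], rule reaches_step)
      (simp add: step_simps reaches_refl xy(3))
  ultimately show ?case
    by (intro reaches_step[of "prod_encode (n, push (run (code (Pairing p q))) R)"])
      (simp add: step_simps del: code.simps, rule reaches_trans)
next
  case (Comp p q)
  then obtain x where "eval {} q n = Some x" "eval {} p x = Some v"
    by (auto split: bind_splits)
  then have "reaches (prod_encode (n, push (run (code q)) (push (run (code p)) R)))
      (prod_encode (v, R))"
    using reaches_trans[OF Comp.IH(2) Comp.IH(1)] by blast
  then show ?case
    by (intro reaches_step[of "prod_encode (n, push (run (code (Comp p q))) R)"])
      (simp add: step_simps del: code.simps)
next
  case (Prec p q)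
  define a m where "a = p1 n" and "m = p2 n"
  let ?F = "\<lambda>k. rec_nat (eval {} p a)
      (\<lambda>k r. Option.bind r (\<lambda>v. eval {} q (prod_encode (a, prod_encode (k, v))))) k"
  let ?S = "prod_encode (n, push (run (code (Prec p q))) R)"
  \<comment> \<open>Loop invariant: when the frame records \<open>k\<close> rounds, the current
    value is the \<open>k\<close>-th iterate.\<close>
  have *: "reaches ?S (prod_encode (w, push (loop (code q) a k m) R))"
    if "k \<le> m" "?F k = Some w" for k w
    using that
  proof (induction k arbitrary: w)
    case 0
    then show ?case
      using Prec.IH(1)[of a w]
      by (intro reaches_step[of ?S]) (simp add: step_simps a_def m_def del: code.simps)
  next
    case (Suc k)
    then obtain u where u: "?F k = Some u" "eval {} q (prod_encode (a, prod_encode (k, u))) = Some w"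
      by (auto split: bind_splits)
    have "reaches ?S (prod_encode (u, push (loop (code q) a k m) R))"
      using Suc u by simp
    moreover have "reaches \<dots> (prod_encode (w, push (loop (code q) a (Suc k) m) R))"
      using Suc.prems Prec.IH(2)[OF u(2)] by (simp add: step_simps reaches_step)
    ultimately show ?case by (rule reaches_trans)
  qed
  have "?F m = Some v"
    using Prec.prems by (simp add: a_def m_def Let_def)
  then have "reaches ?S (prod_encode (v, push (loop (code q) a m m) R))"
    using * by blast
  moreover have "reaches \<dots> (prod_encode (v, R))"
    by (rule reaches_single) (simp add: step_simps)
  ultimately show ?case by (rule reaches_trans)
next
  case (Mini p)
  let ?S = "prod_encode (n, push (run (code (Mini p))) R)"
  obtain k where k: "eval {} p (prod_encode (n, k)) = Some 0"
      "\<forall>j<k. eval {} p (prod_encode (n, j)) \<noteq> None"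
    and v_eq: "v = (LEAST k. eval {} p (prod_encode (n, k)) = Some 0)"
    using Mini.prems by (auto split: if_splits)
  have v: "eval {} p (prod_encode (n, v)) = Some 0"
    unfolding v_eq by (rule LeastI, rule k)
  have "v \<le> k"
    unfolding v_eq by (rule Least_le, rule k)
  then have below: "eval {} p (prod_encode (n, j)) \<noteq> None" if "j < v" for j
    using that k(2) by simp
  have below0: "eval {} p (prod_encode (n, j)) \<noteq> Some 0" if "j < v" for j
    using that unfolding v_eq by (rule not_less_Least)
  \<comment> \<open>Each candidate below \<open>v\<close> gives a defined nonzero value, so the
    search moves on until it tests \<open>v\<close>.\<close>
  have "reaches ?S (prod_encode (prod_encode (n, k),
      push (run (code p)) (push (search (code p) n k) R)))" if "k \<le> v" for k
    using that
  proof (induction k)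
    case 0
    show ?case by (rule reaches_single) (simp add: step_simps del: code.simps)
  next
    case (Suc k)
    obtain w where w: "eval {} p (prod_encode (n, k)) = Some w" "w \<noteq> 0"
      using below[of k] below0[of k] Suc.prems by auto
    have "reaches (prod_encode (w, push (search (code p) n k) R)) (prod_encode
        (prod_encode (n, Suc k), push (run (code p)) (push (search (code p) n (Suc k)) R)))"
      using w(2) by (intro reaches_single) (simp add: step_simps)
    then show ?case
      using reaches_trans[OF reaches_trans[OF Suc.IH Mini.IH[OF w(1)]]] Suc.prems by simp
  qed
  moreover have "reaches (prod_encode (0, push (search (code p) n v) R)) (prod_encode (v, R))"
    by (rule reaches_single) (simp add: step_simps)
  ultimately show ?case
    using reaches_trans[OF _ reaches_trans[OF Mini.IH[OF v]]] by blast
qed (rule reaches_single, simp add: step_simps del: code.simps)+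

lemma halts_within_Suc: "halts_within (Suc r) s \<longleftrightarrow> halts_within r (step s)"
  unfolding halts_within_def by (simp add: funpow_swap1)

text \<open>Final states are fixed points of \<open>step\<close>.\<close>

lemma halts_within_mono: "r \<le> r' \<Longrightarrow> halts_within r s \<Longrightarrow> halts_within r' s"
  by (induction r' rule: dec_induct) (simp_all add: halts_within_def step_def)

lemma halts_within_pushD:
  "halts_within r (prod_encode (v, push f R)) \<Longrightarrow>
    \<exists>r'. r = Suc r' \<and> halts_within r' (step (prod_encode (v, push f R)))"
  by (cases r) (simp_all add: halts_within_Suc, simp add: halts_within_def push_def)

text \<open>The bound \<open>r' < r\<close> allows induction on the number of steps for the two loops.\<close>

lemma eval_of_halts_within:
  "halts_within r (prod_encode (n, push (run (code p)) R)) \<Longrightarrow>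
    \<exists>v r'. eval {} p n = Some v \<and> r' < r \<and> halts_within r' (prod_encode (v, R))"
proof (induction p arbitrary: r n R)
  case (Pairing p q)
  obtain r1 where r1: "r = Suc r1"
      "halts_within r1 (prod_encode (n, push (run (code p)) (push (pairL (code q) n) R)))"
    using halts_within_pushD[OF Pairing.prems] by (auto simp: step_run run_step_code(6) simp del: code.simps)
  obtain x r2 where x: "eval {} p n = Some x" "r2 < r1"
      "halts_within r2 (prod_encode (x, push (pairL (code q) n) R))"
    using Pairing.IH(1)[OF r1(2)] by blast
  obtain r3 where r3: "r2 = Suc r3"
      "halts_within r3 (prod_encode (n, push (run (code q)) (push (pairR x) R)))"
    using halts_within_pushD[OF x(3)] by (auto simp: step_pairL)
  obtain y r4 where y: "eval {} q n = Some y" "r4 < r3"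
      "halts_within r4 (prod_encode (y, push (pairR x) R))"
    using Pairing.IH(2)[OF r3(2)] by blast
  obtain r5 where "r4 = Suc r5" "halts_within r5 (prod_encode (prod_encode (x, y), R))"
    using halts_within_pushD[OF y(3)] by (auto simp: step_pairR)
  then show ?case
    using r1(1) x(1,2) r3(1) y(1,2) by (intro exI[of _ "prod_encode (x, y)"] exI[of _ r5]) simp
next
  case (Comp p q)
  obtain r1 where r1: "r = Suc r1"
      "halts_within r1 (prod_encode (n, push (run (code q)) (push (run (code p)) R)))"
    using halts_within_pushD[OF Comp.prems] by (auto simp: step_run run_step_code(7) simp del: code.simps)
  obtain x r2 where x: "eval {} q n = Some x" "r2 < r1"
      "halts_within r2 (prod_encode (x, push (run (code p)) R))"
    using Comp.IH(2)[OF r1(2)] by blast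
  obtain y r3 where "eval {} p x = Some y" "r3 < r2" "halts_within r3 (prod_encode (y, R))"
    using Comp.IH(1)[OF x(3)] by blast
  then show ?case
    using r1(1) x(1,2) by (intro exI[of _ y] exI[of _ r3]) simp
next
  case (Prec p q)
  define a m where "a = p1 n" and "m = p2 n"
  let ?F = "\<lambda>k. rec_nat (eval {} p a)
      (\<lambda>k r. Option.bind r (\<lambda>v. eval {} q (prod_encode (a, prod_encode (k, v))))) k"
  \<comment> \<open>The loop exits only at \<open>k = m\<close>. Induction on the remaining number
    of steps, not on \<open>k\<close>, therefore shows that halting forces the remaining rounds to
    be defined.\<close>
  have *: "\<exists>v r'. ?F m = Some v \<and> r' < r \<and> halts_within r' (prod_encode (v, R))"
    if "halts_within r (prod_encode (w, push (loop (code q) a k m) R))" "?F k = Some w" for r k w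
    using that
  proof (induction r arbitrary: k w rule: less_induct)
    case (less r)
    show ?case
    proof (cases "k = m")
      case True
      with less.prems(2) halts_within_pushD[OF less.prems(1)] show ?thesis
        by (auto simp: step_loop)
    next
      case False
      then obtain r1 where r1: "r = Suc r1" "halts_within r1 (prod_encode
          (prod_encode (a, prod_encode (k, w)), push (run (code q)) (push (loop (code q) a (Suc k) m) R)))"
        using halts_within_pushD[OF less.prems(1)] by (auto simp: step_loop)
      obtain u r2 where u: "eval {} q (prod_encode (a, prod_encode (k, w))) = Some u" "r2 < r1"
          "halts_within r2 (prod_encode (u, push (loop (code q) a (Suc k) m) R))"
        using Prec.IH(2)[OF r1(2)] by blast
      have "\<exists>v r'. ?F m = Some v \<and> r' < r2 \<and> halts_within r' (prod_encode (v, R))"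
        using u r1(1) less.prems(2) by (intro less.IH[of r2 u "Suc k"]) auto
      then show ?thesis
        using u(2) r1(1) by (meson less_SucI less_trans)
    qed
  qed
  obtain r1 where r1: "r = Suc r1"
      "halts_within r1 (prod_encode (a, push (run (code p)) (push (loop (code q) a 0 m) R)))"
    using halts_within_pushD[OF Prec.prems] by (auto simp: step_run run_step_code(8) a_def m_def simp del: code.simps)
  obtain w r2 where w: "eval {} p a = Some w" "r2 < r1"
      "halts_within r2 (prod_encode (w, push (loop (code q) a 0 m) R))"
    using Prec.IH(1)[OF r1(2)] by blast
  have "\<exists>v r'. ?F m = Some v \<and> r' < r2 \<and> halts_within r' (prod_encode (v, R))"
    using *[OF w(3)] w(1) by simp
  moreover have "eval {} (Prec p q) n = ?F m"
    by (simp add: a_def m_def Let_def)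
  ultimately show ?case
    using w(2) r1(1) by (metis less_SucI less_trans)
next
  case (Mini p)
  \<comment> \<open>The second premise records that earlier candidates gave defined nonzero values.
    When a zero appears at \<open>k\<close>, it is thus the least one and meets the definedness
    condition in \<open>eval\<close>.\<close>
  have *: "\<exists>v r'. eval {} (Mini p) n = Some v \<and> r' < r \<and> halts_within r' (prod_encode (v, R))"
    if "halts_within r (prod_encode (prod_encode (n, k),
        push (run (code p)) (push (search (code p) n k) R)))"
      "\<forall>j<k. eval {} p (prod_encode (n, j)) \<notin> {None, Some 0}" for r k
    using that
  proof (induction r arbitrary: k rule: less_induct)
    case (less r)
    obtain w r1 where w: "eval {} p (prod_encode (n, k)) = Some w" "r1 < r"
        "halts_within r1 (prod_encode (w, push (search (code p) n k) R))"
      using Mini.IH[OF less.prems(1)] by blast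
    show ?case
    proof (cases "w = 0")
      case True
      have "(LEAST k. eval {} p (prod_encode (n, k)) = Some 0) = k"
        using less.prems(2) w(1) True by (intro Least_equality) (auto simp flip: not_less)
      then have "eval {} (Mini p) n = Some k"
        using less.prems(2) w(1) True by auto
      moreover obtain r2 where "r1 = Suc r2" "halts_within r2 (prod_encode (k, R))"
        using halts_within_pushD[OF w(3)] True by (auto simp: step_search)
      ultimately show ?thesis
        using w(2) by (intro exI[of _ k] exI[of _ r2]) simp
    next
      case False
      obtain r2 where r2: "r1 = Suc r2" "halts_within r2 (prod_encode (prod_encode (n, Suc k),
          push (run (code p)) (push (search (code p) n (Suc k)) R)))"
        using halts_within_pushD[OF w(3)] False by (auto simp: step_search)
      have "\<exists>v r'. eval {} (Mini p) n = Some v \<and> r' < r2 \<and> halts_within r' (prod_encode (v, R))"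
        using r2 w False less.prems(2) by (intro less.IH[of r2 "Suc k"]) (auto simp: less_Suc_eq)
      then show ?thesis
        using r2(1) w(2) by (meson less_SucI less_trans)
    qed
  qed
  obtain r1 where "r = Suc r1" "halts_within r1 (prod_encode (prod_encode (n, 0),
      push (run (code p)) (push (search (code p) n 0) R)))"
    using halts_within_pushD[OF Mini.prems] by (auto simp: step_run run_step_code(9) simp del: code.simps)
  then show ?case
    using *[of r1 0] by (metis less_SucI not_less0)
qed (drule halts_within_pushD, force simp: step_run run_step_code(1-5) simp del: code.simps)+

section \<open>Decidable stages of the halting set\<close>

definition halting_stage :: "nat \<Rightarrow> nat set" where
  "halting_stage r = {x. halts_within r (prod_encode (x, push (run x) 0))}"

lemma decidable_in_halting_stage [computable_intros]:
  assumes "computable_in A f" "computable_in A g"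
  shows "decidable_in A (\<lambda>n. f n \<in> halting_stage (g n))"
  unfolding halting_stage_def mem_Collect_eq using assms by (intro computable_intros)

lemma mono_halting_stage: "mono halting_stage"
  by (rule monoI) (auto simp: halting_stage_def intro: halts_within_mono)

text \<open>Every number is the code of exactly one program, so the stages need no test for valid
  codes; the rest is correctness of the machine in both directions.\<close>

lemma halting_set_eq: "halting_set = (\<Union>r. halting_stage r)"
proof (intro set_eqI)
  fix x
  obtain p where p: "x = code p"
    using ex_code by metis
  have "x \<in> halting_set \<longleftrightarrow> eval {} p x \<noteq> None"
    unfolding halting_set_def jump_def p using inj_code by (auto dest: injD)
  also have "\<dots> \<longleftrightarrow> (\<exists>r. halts_within r (prod_encode (x, push (run x) 0)))"
  proof
    assume "eval {} p x \<noteq> None"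
    then obtain v where "eval {} p x = Some v" by blast
    from reaches_eval[OF this, of 0]
    show "\<exists>r. halts_within r (prod_encode (x, push (run x) 0))"
      unfolding reaches_def halts_within_def p by (metis prod_encode_inverse snd_conv)
  next
    assume "\<exists>r. halts_within r (prod_encode (x, push (run x) 0))"
    then show "eval {} p x \<noteq> None"
      using eval_of_halts_within[of _ x p 0] unfolding p by blast
  qed
  finally show "x \<in> halting_set \<longleftrightarrow> x \<in> (\<Union>r. halting_stage r)"
    by (simp add: halting_stage_def)
qed

section \<open>Counting gaps in binary expansions\<close>

text \<open>A gap of \<open>E\<close> is represented by its lower end.\<close>

definition gaps :: "(nat \<Rightarrow> nat \<Rightarrow> bool) \<Rightarrow> nat set \<Rightarrow> nat set" where
  "gaps S E = {t \<in> E. \<exists>s\<in>E. t < s \<and> \<not> (\<exists>u\<in>E. t < u \<and> u < s) \<and> S t s}"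

definition short :: "(nat \<Rightarrow> nat set) \<Rightarrow> nat \<Rightarrow> nat \<Rightarrow> bool" where
  "short K t s \<longleftrightarrow> (\<exists>x\<le>t. x \<in> (\<Union>r. K r) \<and> x \<notin> K s)"

text \<open>Unlike \<open>short\<close>, this refers only to the stages in \<open>E\<close>, which makes it decidable.\<close>

definition very_short :: "(nat \<Rightarrow> nat set) \<Rightarrow> nat set \<Rightarrow> nat \<Rightarrow> nat \<Rightarrow> bool" where
  "very_short K E t s \<longleftrightarrow> (\<exists>x\<le>t. x \<in> (\<Union>r\<in>E. K r) \<and> x \<notin> K s)"

lemma gaps_cong:
  "(\<And>t s. t \<in> E \<Longrightarrow> s \<in> E \<Longrightarrow> S t s \<longleftrightarrow> S' t s) \<Longrightarrow> gaps S E = gaps S' E"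
  unfolding gaps_def by blast

text \<open>Since \<open>F\<close> lies above \<open>E\<close>, consecutive elements of the union
  are consecutive in \<open>E\<close> or in \<open>F\<close>, except for the one new pair
  \<open>Max E\<close>, \<open>Min F\<close>.\<close>

lemma gaps_Un:
  assumes "finite E" "E \<noteq> {}" "finite F" "F \<noteq> {}" and less: "\<forall>t\<in>E. \<forall>s\<in>F. t < s"
  shows "gaps S (E \<union> F) = gaps S E \<union> gaps S F \<union> (if S (Max E) (Min F) then {Max E} else {})"
proof (intro set_eqI iffI)
  have M: "Max E \<in> E" "Min F \<in> F" "\<And>t. t \<in> E \<Longrightarrow> t \<le> Max E" "\<And>s. s \<in> F \<Longrightarrow> Min F \<le> s"
    using assms(1-4) by auto
  fix t
  show "t \<in> gaps S E \<union> gaps S F \<union> (if S (Max E) (Min F) then {Max E} else {})"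
    if gap: "t \<in> gaps S (E \<union> F)"
  proof -
    obtain s where ts: "t \<in> E \<union> F" "s \<in> E \<union> F" "t < s" "S t s"
        "\<not> (\<exists>u\<in>E \<union> F. t < u \<and> u < s)"
      using gap unfolding gaps_def by blast
    consider "t \<in> E" "s \<in> E" | "t \<in> F" "s \<in> F" | "t \<in> E" "s \<in> F"
      using ts(1-3) less by (meson UnE less_asym)
    then show ?thesis
    proof cases
      case 1
      then have "t \<in> gaps S E" using ts unfolding gaps_def by blast
      then show ?thesis by blast
    next
      case 2
      then have "t \<in> gaps S F" using ts unfolding gaps_def by blast
      then show ?thesis by blast
    next
      case 3
      \<comment> \<open>Otherwise \<open>Max E\<close> or, in the next line, \<open>Min F\<close>
        would lie strictly between \<open>t\<close> and \<open>s\<close>.\<close>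
      have "\<not> t < Max E" using ts(5) M(1) less 3(2) by blast
      moreover have "\<not> Min F < s" using ts(5) M(2) less 3(1) by blast
      ultimately have "t = Max E" "s = Min F"
        using M(3)[OF 3(1)] M(4)[OF 3(2)] by auto
      then show ?thesis using ts(4) by simp
    qed
  qed
  show "t \<in> gaps S (E \<union> F)"
    if gap: "t \<in> gaps S E \<union> gaps S F \<union> (if S (Max E) (Min F) then {Max E} else {})"
  proof -
    consider "t \<in> gaps S E" | "t \<in> gaps S F" | "t = Max E" "S (Max E) (Min F)"
      using gap by (auto split: if_splits)
    then show ?thesis
    proof cases
      case 1
      then show ?thesis unfolding gaps_def using less by (blast dest: less_asym)
    next
      case 2
      then show ?thesis unfolding gaps_def using less by (blast dest: less_asym)
    next
      case 3
      have "\<not> (\<exists>u\<in>E \<union> F. Max E < u \<and> u < Min F)"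
        using M(3,4) by (auto simp flip: not_le)
      then show ?thesis
        unfolding gaps_def using M(1,2) less 3 by blast
    qed
  qed
qed

lemma card_gaps_Un:
  assumes "finite E" "E \<noteq> {}" "finite F" "F \<noteq> {}" and less: "\<forall>t\<in>E. \<forall>s\<in>F. t < s"
  shows "card (gaps S (E \<union> F)) =
    card (gaps S E) + card (gaps S F) + (if S (Max E) (Min F) then 1 else 0)"
proof -
  \<comment> \<open>\<open>Max E\<close> has no successor inside \<open>E\<close>, so it is not yet
    counted as the lower end of a gap of \<open>E\<close>.\<close>
  have sub: "gaps S E \<subseteq> E - {Max E}" "gaps S F \<subseteq> F"
    using assms(1) by (auto simp: gaps_def) (metis Max_ge not_le)
  have fin: "finite (gaps S E)" "finite (gaps S F)"
    using sub assms(1,3) by (meson finite_Diff finite_subset)+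
  have "Max E \<in> E" using assms(1,2) by simp
  then have "Max E \<notin> gaps S E \<union> gaps S F" "gaps S E \<inter> gaps S F = {}"
    using sub less by blast+
  then show ?thesis
    unfolding gaps_Un[OF assms] using fin by (auto simp: card_Un_disjoint)
qed

text \<open>Finitely many numbers are concerned; the maximum of their entry stages works by
  monotonicity.\<close>

lemma ex_settled_stage:
  assumes "mono (K :: nat \<Rightarrow> nat set)"
  shows "\<exists>s. \<forall>t\<ge>s. \<forall>x\<le>m. x \<in> (\<Union>r. K r) \<longrightarrow> x \<in> K t"
proof -
  have "\<forall>x. \<exists>s. x \<in> (\<Union>r. K r) \<longrightarrow> x \<in> K s" by blast
  then obtain f where f: "\<And>x. x \<in> (\<Union>r. K r) \<Longrightarrow> x \<in> K (f x)" by metis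
  have "x \<in> K t" if "t \<ge> Max (f ` {..m})" "x \<le> m" "x \<in> (\<Union>r. K r)" for t x
  proof -
    have "f x \<le> t" using that by (meson Max_ge atMost_iff finite_atMost finite_imageI imageI le_trans)
    then show ?thesis using f[OF that(3)] monoD[OF assms, of "f x" t] by blast
  qed
  then show ?thesis by blast
qed

text \<open>Stages in \<open>F\<close> already show all of the limit up to \<open>Max E\<close>, so
  for gaps of \<open>E\<close> very short becomes short. For gaps of \<open>F\<close> the stages in
  \<open>E\<close> are too early to reveal anything new. The gap between \<open>E\<close> and
  \<open>F\<close> is not very short, because \<open>Min F\<close> is a settled stage for
  \<open>Max E\<close>.\<close>

lemma card_gaps_very_short_Un:
  assumes "mono K" "finite E" "E \<noteq> {}" "finite F" "F \<noteq> {}"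
    and less: "\<forall>t\<in>E. \<forall>s\<in>F. t < s"
    and settled: "\<And>x s. s \<in> F \<Longrightarrow> x \<le> Max E \<Longrightarrow> x \<in> (\<Union>r. K r) \<Longrightarrow> x \<in> K s"
  shows "card (gaps (very_short K (E \<union> F)) (E \<union> F)) =
    card (gaps (short K) E) + card (gaps (very_short K F) F)"
proof -
  have "very_short K (E \<union> F) t s \<longleftrightarrow> short K t s" if "t \<in> E" for t s
  proof -
    have "t \<le> Max E" using assms(2) that by simp
    moreover obtain s' where "s' \<in> F" using assms(5) by blast
    ultimately have "x \<in> (\<Union>r\<in>E \<union> F. K r) \<longleftrightarrow> x \<in> (\<Union>r. K r)" if "x \<le> t" for x
      using settled[of s' x] that by auto
    then show ?thesis unfolding very_short_def short_def by blast
  qed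
  then have "gaps (very_short K (E \<union> F)) E = gaps (short K) E"
    by (intro gaps_cong) auto
  moreover have "very_short K (E \<union> F) t s \<longleftrightarrow> very_short K F t s" if "s \<in> F" for t s
  proof -
    have "K r \<subseteq> K s" if "r \<in> E" for r
      using less that \<open>s \<in> F\<close> by (intro monoD[OF assms(1)]) (simp add: less_imp_le)
    then show ?thesis unfolding very_short_def by blast
  qed
  then have "gaps (very_short K (E \<union> F)) F = gaps (very_short K F) F"
    by (intro gaps_cong) auto
  moreover have "\<not> very_short K (E \<union> F) (Max E) (Min F)"
    unfolding very_short_def using settled[of "Min F"] assms(4,5) by auto
  ultimately show ?thesis
    using card_gaps_Un[OF assms(2-5) less] by simp
qed

section \<open>Sums of apart sets\<close>

lemma exponents_nonempty: "0 < n \<Longrightarrow> exponents n \<noteq> {}"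
  by (metis less_irrefl sum.empty sum_exponents)

lemma exponents_less_imp_less:
  assumes "exponents n \<subseteq> {..<m}"
  shows "n < 2 ^ m"
proof -
  have "n = (\<Sum>t\<in>exponents n. 2 ^ t)" by (rule sum_exponents[symmetric])
  also have "\<dots> \<le> (\<Sum>t<m. 2 ^ t)" by (rule sum_mono2) (use assms in auto)
  also have "\<dots> < 2 ^ m" by (simp add: lessThan_atLeast0 sum_power2)
  finally show ?thesis .
qed

lemma exponents_less: "t \<in> exponents n \<Longrightarrow> t < n"
proof -
  assume "t \<in> exponents n"
  then have "2 ^ t \<le> (\<Sum>t\<in>exponents n. (2::nat) ^ t)"
    by (intro member_le_sum) (auto simp: finite_exponents)
  then show "t < n" using less_le_trans[OF less_exp] by (simp add: sum_exponents)
qed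

text \<open>Disjoint binary digits cause no carry, so the sum is the bitwise or.\<close>

lemma exponents_add:
  assumes "exponents m \<inter> exponents n = {}"
  shows "exponents (m + n) = exponents m \<union> exponents n"
proof -
  have "and m n = 0"
    using assms by (auto intro!: bit_eqI simp: bit_and_iff exponents_def)
  then have "m + n = or m n" by (rule disjunctive_add_eq_or)
  then show ?thesis by (auto simp: exponents_def bit_or_iff)
qed

lemma apart_exponents:
  assumes "apart H" "x \<in> H" "y \<in> H" "x < y" "t \<in> exponents x" "s \<in> exponents y"
  shows "t < s"
proof -
  have "t \<le> highest_exponent x" "lowest_exponent y \<le> s"
    using assms(5,6) finite_exponents by (simp_all add: highest_exponent_def lowest_exponent_def)
  then show ?thesis using assms(1-4) unfolding apart_def by fastforce
qed

lemma apart_UN_exponents: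
  assumes "apart H" "A \<subseteq> H" "B \<subseteq> H" "\<And>x y. x \<in> A \<Longrightarrow> y \<in> B \<Longrightarrow> x < y"
  shows "\<forall>t\<in>(\<Union>x\<in>A. exponents x). \<forall>s\<in>(\<Union>y\<in>B. exponents y). t < s"
proof (intro ballI)
  fix t s assume "t \<in> (\<Union>x\<in>A. exponents x)" "s \<in> (\<Union>y\<in>B. exponents y)"
  then obtain x y where "x \<in> A" "t \<in> exponents x" "y \<in> B" "s \<in> exponents y" by blast
  then show "t < s" using assms(2,3) by (intro apart_exponents[OF assms(1) _ _ assms(4), of x y]) blast+
qed

text \<open>Apartness makes the exponents of distinct elements disjoint, so no addition
  carries.\<close>

lemma exponents_Sum:
  assumes "apart H" "finite F" "F \<subseteq> H"
  shows "exponents (\<Sum>F) = (\<Union>x\<in>F. exponents x)"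
  using assms(2,3)
proof (induction F)
  case empty
  show ?case by (simp add: exponents_def)
next
  case (insert x F)
  have "t \<notin> exponents y" if "y \<in> F" "t \<in> exponents x" for t y
  proof
    assume t: "t \<in> exponents y"
    have "x \<noteq> y" using insert(2) that(1) by blast
    moreover have "\<not> x < y"
      using apart_exponents[OF assms(1), of x y t t] insert.prems that t by blast
    moreover have "\<not> y < x"
      using apart_exponents[OF assms(1), of y x t t] insert.prems that t by blast
    ultimately show False by simp
  qed
  moreover have IH: "exponents (\<Sum>F) = (\<Union>x\<in>F. exponents x)"
    using insert by simp
  ultimately have "exponents x \<inter> exponents (\<Sum>F) = {}" by blast
  then have "exponents (x + \<Sum>F) = exponents x \<union> (\<Union>x\<in>F. exponents x)"
    by (simp only: exponents_add IH)
  then show ?case using insert(1,2) by simp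
qed

lemma UN_exponents:
  assumes "A \<subseteq> H" "finite A" "A \<noteq> {}" "\<forall>x\<in>H. 0 < x"
  shows "finite (\<Union>x\<in>A. exponents x)" "(\<Union>x\<in>A. exponents x) \<noteq> {}"
  using assms exponents_nonempty by (auto simp: finite_exponents) blast

lemma le_highest_exponent:
  assumes "2 ^ m \<le> n"
  shows "m \<le> highest_exponent n"
proof -
  have "\<not> exponents n \<subseteq> {..<m}"
    using exponents_less_imp_less[of n m] assms by auto
  then obtain t where "t \<in> exponents n" "m \<le> t" by (auto simp flip: not_less)
  then show ?thesis
    unfolding highest_exponent_def using Max_ge[OF finite_exponents] by (meson le_trans)
qed

lemma highest_exponent_mem: "0 < n \<Longrightarrow> highest_exponent n \<in> exponents n"
  unfolding highest_exponent_def by (rule Max_in[OF finite_exponents exponents_nonempty])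

lemma lowest_exponent_mem: "0 < n \<Longrightarrow> lowest_exponent n \<in> exponents n"
  unfolding lowest_exponent_def by (rule Min_in[OF finite_exponents exponents_nonempty])

text \<open>With \<open>Min_UN_exponents\<close>, this reduces the gap between two sums to the one
  summand on either side of it.\<close>

lemma Max_UN_exponents:
  assumes "apart H" "\<forall>x\<in>H. 0 < x" "A \<subseteq> H" "finite A" "h \<in> A" "\<And>x. x \<in> A \<Longrightarrow> x \<le> h"
  shows "Max (\<Union>x\<in>A. exponents x) = highest_exponent h"
proof (rule Max_eqI)
  have h: "highest_exponent h \<in> exponents h"
    using assms highest_exponent_mem by blast
  then show "highest_exponent h \<in> (\<Union>x\<in>A. exponents x)"
    using assms by blast
  fix t assume "t \<in> (\<Union>x\<in>A. exponents x)"
  then obtain x where x: "x \<in> A" "t \<in> exponents x" by blast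
  show "t \<le> highest_exponent h"
  proof (cases "x = h")
    case True
    then show ?thesis using x Max_ge[OF finite_exponents] by (simp add: highest_exponent_def)
  next
    case False
    then show ?thesis
      using apart_exponents[OF assms(1), of x h t] assms(3,5,6) x h by (force intro: less_imp_le)
  qed
qed (use assms finite_exponents in auto)

lemma Min_UN_exponents:
  assumes "apart H" "\<forall>x\<in>H. 0 < x" "A \<subseteq> H" "finite A" "h \<in> A" "\<And>x. x \<in> A \<Longrightarrow> h \<le> x"
  shows "Min (\<Union>x\<in>A. exponents x) = lowest_exponent h"
proof (rule Min_eqI)
  have h: "lowest_exponent h \<in> exponents h"
    using assms lowest_exponent_mem by blast
  then show "lowest_exponent h \<in> (\<Union>x\<in>A. exponents x)"
    using assms by blast
  fix t assume "t \<in> (\<Union>x\<in>A. exponents x)"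
  then obtain x where x: "x \<in> A" "t \<in> exponents x" by blast
  show "lowest_exponent h \<le> t"
  proof (cases "x = h")
    case True
    then show ?thesis using x Min_le[OF finite_exponents] by (simp add: lowest_exponent_def)
  next
    case False
    then show ?thesis
      using apart_exponents[OF assms(1), of h x _ t] assms(3,5,6) x h by (force intro: less_imp_le)
  qed
qed (use assms finite_exponents in auto)

text \<open>A large number may have small exponents. Here apartness puts those of \<open>y\<close>
  above the highest exponent of the smaller element \<open>h\<close>, which is at least
  \<open>s\<close>.\<close>

lemma apart_le_exponent:
  assumes "apart H" "h \<in> H" "y \<in> H" "2 ^ s \<le> h" "h < y" "t \<in> exponents y"
  shows "s \<le> t"
proof -
  have "0 < h" using assms(4) by (rule less_le_trans[rotated]) simp
  then have "highest_exponent h < t"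
    using apart_exponents[OF assms(1-3,5) _ assms(6)] highest_exponent_mem by blast
  then show ?thesis using le_highest_exponent[OF assms(4)] by simp
qed

section \<open>The coloring and its computability\<close>

definition color :: "nat \<Rightarrow> nat" where
  "color n = card (gaps (very_short halting_stage (exponents n)) (exponents n)) mod 2"

text \<open>Exponents of \<open>n\<close> are less than \<open>n\<close>, so every quantifier in the
  definition can be bounded, including the one over stages.\<close>

lemma computable_color: "computable color"
proof -
  let ?P = "\<lambda>n t. bit n t \<and> (\<exists>s<n. bit n s \<and> t < s \<and> \<not> (\<exists>u<n. bit n u \<and> t < u \<and> u < s) \<and>
      (\<exists>x<Suc t. (\<exists>r<n. bit n r \<and> x \<in> halting_stage r) \<and> \<not> x \<in> halting_stage s))"
  have ex: "(\<exists>t\<in>exponents n. Q t) \<longleftrightarrow> (\<exists>t<n. bit n t \<and> Q t)" for n Q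
    using exponents_less[of _ n] by (auto simp: exponents_def)
  have "gaps (very_short halting_stage (exponents n)) (exponents n) = {t \<in> {..<n}. ?P n t}" for n
    unfolding gaps_def very_short_def ex UN_iff less_Suc_eq_le using exponents_less[of _ n]
    by (auto simp: exponents_def)
  then have "color = (\<lambda>n. (\<Sum>t<n. if ?P n t then 1 else 0) mod 2)"
    by (intro ext) (simp only: color_def card_eq_sum sum.inter_filter finite_lessThan)
  moreover have "computable_in {} (\<lambda>n. (\<Sum>t<n. if ?P n t then 1 else 0) mod 2)"
    by (intro computable_intros)
  ultimately show ?thesis by (simp only: computable_def)
qed

section \<open>Parity of the number of short gaps\<close>

lemma Sum_in_FS: "F \<subseteq> H \<Longrightarrow> finite F \<Longrightarrow> card F \<in> J \<Longrightarrow> \<Sum>F \<in> FS J H"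
  unfolding FS_def by blast

lemma ex_finite_subset_above:
  assumes "infinite (H :: nat set)"
  obtains B where "B \<subseteq> H" "finite B" "card B = n" "\<And>y. y \<in> B \<Longrightarrow> h < y"
proof -
  have "infinite (H - {..h})" using assms by simp
  then obtain B where "finite B" "card B = n" "B \<subseteq> H - {..h}"
    using infinite_arbitrarily_large[of "H - {..h}" n] by auto
  then show ?thesis by (intro that[of B]) auto
qed

text \<open>For \<open>B\<close> consisting of \<open>b\<close> elements far beyond
  \<open>A\<close>, the sums of \<open>A \<union> B\<close> and of \<open>B\<close> have the same
  color, and by \<open>card_gaps_very_short_Un\<close> their counts differ by the number of short
  gaps of \<open>A\<close>. The lemma is later applied to sets of \<open>a\<close> and of
  \<open>a + b\<close> elements.\<close>

lemma even_card_gaps: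
  assumes H: "infinite H" "\<forall>x\<in>H. 0 < x" "apart H"
    and mono: "monochromatic color (FS J H)" and J: "a + b \<in> J" "b \<in> J" "0 < a" "0 < b"
    and A: "A \<subseteq> H" "finite A" "card A = a"
  shows "even (card (gaps (short halting_stage) (\<Union>x\<in>A. exponents x)))"
proof -
  let ?E = "\<Union>x\<in>A. exponents x"
  obtain s where s: "\<And>t x. t \<ge> s \<Longrightarrow> x \<le> Max ?E \<Longrightarrow> x \<in> (\<Union>r. halting_stage r) \<Longrightarrow> x \<in> halting_stage t"
    using ex_settled_stage[OF mono_halting_stage, of "Max ?E"] by blast
  \<comment> \<open>An element \<open>h\<close> beyond \<open>N\<close> exceeds all of
    \<open>A\<close> and is at least \<open>2 ^ s\<close>. It separates \<open>A\<close> from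
    \<open>B\<close>: elements above \<open>h\<close> have only exponents from \<open>s\<close>
    on.\<close>
  define N where "N = \<Sum>A + 2 ^ s"
  obtain h where h: "h \<in> H" "N < h"
    using ex_finite_subset_above[OF H(1), of 1 N] by (metis card_1_singletonE insert_subset singletonI)
  obtain B where B: "B \<subseteq> H" "finite B" "card B = b" and B_h: "\<And>y. y \<in> B \<Longrightarrow> h < y"
    using ex_finite_subset_above[OF H(1), of b h] by blast
  let ?F = "\<Union>x\<in>B. exponents x"
  have A_h: "x < h" if "x \<in> A" for x
    using member_le_sum[of x A "\<lambda>x. x"] that A(2) h(2) by (simp add: N_def)
  have F_s: "s \<le> t" if t: "t \<in> ?F" for t
  proof -
    obtain y where y: "y \<in> B" "t \<in> exponents y" using t by blast
    have "2 ^ s \<le> h" using h(2) by (simp add: N_def)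
    then show ?thesis
      using apart_le_exponent[OF H(3) h(1) _ _ B_h[OF y(1)] y(2)] y(1) B(1) by blast
  qed
  have ne: "A \<noteq> {}" "B \<noteq> {}" using A B J by auto
  have E: "finite ?E" "?E \<noteq> {}"
    using UN_exponents[of A H] ne A H(2) by auto
  have F: "finite ?F" "?F \<noteq> {}"
    using UN_exponents[of B H] ne B H(2) by auto
  have less: "\<forall>t\<in>?E. \<forall>s\<in>?F. t < s"
    by (rule apart_UN_exponents[OF H(3) A(1) B(1)]) (use A_h B_h less_trans in blast)
  have disj: "A \<inter> B = {}" using A_h B_h less_asym by blast
  have "\<Sum>(A \<union> B) \<in> FS J H" "\<Sum>B \<in> FS J H"
    using A B J disj by (simp_all add: Sum_in_FS card_Un_disjoint)
  then have "color (\<Sum>(A \<union> B)) = color (\<Sum>B)"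
    using mono unfolding monochromatic_def by blast
  moreover have "exponents (\<Sum>(A \<union> B)) = ?E \<union> ?F" "exponents (\<Sum>B) = ?F"
    using exponents_Sum[OF H(3), of "A \<union> B"] exponents_Sum[OF H(3), of B] A B by auto
  moreover have "card (gaps (very_short halting_stage (?E \<union> ?F)) (?E \<union> ?F)) =
      card (gaps (short halting_stage) ?E) + card (gaps (very_short halting_stage ?F) ?F)"
    by (rule card_gaps_very_short_Un[OF mono_halting_stage E F less]) (rule s[OF F_s])
  ultimately have "(card (gaps (short halting_stage) ?E) +
      card (gaps (very_short halting_stage ?F) ?F)) mod 2 =
      card (gaps (very_short halting_stage ?F) ?F) mod 2"
    by (simp only: color_def)
  moreover have "even x" if "(x + y) mod 2 = y mod 2" for x y :: nat
    using that by presburger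
  ultimately show ?thesis by blast
qed

text \<open>\<open>A\<close> and \<open>A \<union> B\<close> both have an even number of short gaps,
  so the gap between \<open>A\<close> and \<open>B\<close> must compensate the parity of
  \<open>B\<close>. The left side does not mention \<open>A\<close>, which allows exchanging
  \<open>A\<close> for another set.\<close>

lemma even_card_gaps_iff_short:
  assumes H: "infinite H" "\<forall>x\<in>H. 0 < x" "apart H"
    and mono: "monochromatic color (FS {a, a + b, a + 2 * b, b} H)" and "0 < a" "0 < b"
    and A: "A \<subseteq> H" "finite A" "card A = a" and B: "B \<subseteq> H" "finite B" "card B = b"
    and AB: "\<And>x y. x \<in> A \<Longrightarrow> y \<in> B \<Longrightarrow> x < y"
  shows "even (card (gaps (short halting_stage) (\<Union>x\<in>B. exponents x))) \<longleftrightarrow>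
    \<not> short halting_stage (Max (\<Union>x\<in>A. exponents x)) (Min (\<Union>x\<in>B. exponents x))"
proof -
  let ?E = "\<Union>x\<in>A. exponents x" and ?F = "\<Union>x\<in>B. exponents x"
  have disj: "A \<inter> B = {}" using AB less_irrefl by blast
  have ne: "A \<noteq> {}" "B \<noteq> {}" using A B assms by auto
  have E: "finite ?E" "?E \<noteq> {}"
    using UN_exponents[of A H] ne A H(2) by auto
  have F: "finite ?F" "?F \<noteq> {}"
    using UN_exponents[of B H] ne B H(2) by auto
  have less: "\<forall>t\<in>?E. \<forall>s\<in>?F. t < s"
    by (rule apart_UN_exponents[OF H(3) A(1) B(1)]) (use AB in blast)
  have "even (card (gaps (short halting_stage) ?E))"
    by (rule even_card_gaps[OF H mono, of a b]) (use assms in auto)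
  moreover have "even (card (gaps (short halting_stage) (\<Union>x\<in>A \<union> B. exponents x)))"
    by (rule even_card_gaps[OF H mono, of "a + b" b])
      (use assms disj in \<open>auto simp: card_Un_disjoint\<close>)
  ultimately show ?thesis
    using card_gaps_Un[OF E F less, of "short halting_stage"] by (auto simp: UN_Un)
qed

text \<open>Two sets of size \<open>a\<close> are compared below the same \<open>B\<close> with
  least element \<open>h'\<close>: a fixed \<open>A\<close>, whose gap to \<open>B\<close> is not
  short because \<open>B\<close> is far away, and one with largest element \<open>h\<close>.\<close>

lemma ex_not_short:
  assumes H: "infinite H" "\<forall>x\<in>H. 0 < x" "apart H"
    and mono: "monochromatic color (FS {a, a + b, a + 2 * b, b} H)" and ab: "0 < a" "0 < b"
  shows "\<exists>C. \<forall>h\<in>H. \<forall>h'\<in>H. C \<le> h \<longrightarrow> h < h' \<longrightarrow>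
    \<not> short halting_stage (highest_exponent h) (lowest_exponent h')"
proof -
  obtain A where A: "A \<subseteq> H" "finite A" "card A = a"
    by (rule ex_finite_subset_above[OF H(1)])
  let ?E = "\<Union>x\<in>A. exponents x"
  obtain s where s: "\<And>t x. t \<ge> s \<Longrightarrow> x \<le> Max ?E \<Longrightarrow> x \<in> (\<Union>r. halting_stage r) \<Longrightarrow> x \<in> halting_stage t"
    using ex_settled_stage[OF mono_halting_stage, of "Max ?E"] by blast
  \<comment> \<open>From \<open>C\<close> on, \<open>h\<close> exceeds all of \<open>A\<close> and
    pushes the exponents of \<open>h'\<close> to \<open>s\<close> or beyond.\<close>
  define C where "C = Suc (\<Sum>A + 2 ^ s)"
  have "\<not> short halting_stage (highest_exponent h) (lowest_exponent h')"
    if h: "h \<in> H" "C \<le> h" and h': "h' \<in> H" "h < h'" for h h'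
  proof -
    have A_h: "x < h" if "x \<in> A" for x
      using member_le_sum[of x A "\<lambda>x. x"] that A(2) h(2) by (simp add: C_def)
    obtain B0 where B0: "B0 \<subseteq> H" "finite B0" "card B0 = b - 1" "\<And>y. y \<in> B0 \<Longrightarrow> h' < y"
      using ex_finite_subset_above[OF H(1), of "b - 1" h'] by blast
    define B where "B = insert h' B0"
    have "h' \<notin> B0" using B0 by auto
    then have B: "B \<subseteq> H" "finite B" "card B = b" and B_h: "\<And>y. y \<in> B \<Longrightarrow> h' \<le> y"
      using B0 h' ab unfolding B_def by (auto intro: less_imp_le)
    \<comment> \<open>One element of \<open>A\<close> is traded for \<open>h\<close>, which keeps
      the size \<open>a\<close>.\<close>
    obtain A0 where A0: "A0 \<subseteq> A" "card A0 = a - 1"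
      using obtain_subset_with_card_n[of "a - 1" A] A(3) by auto
    define A' where "A' = insert h A0"
    have "finite A0" "h \<notin> A0" using A0 A(2) A_h finite_subset by blast+
    then have A': "A' \<subseteq> H" "finite A'" "card A' = a" and A'_h: "\<And>x. x \<in> A' \<Longrightarrow> x \<le> h"
      using A0 A(1) h ab A_h unfolding A'_def by (auto intro: less_imp_le)
    let ?E' = "\<Union>x\<in>A'. exponents x" and ?F = "\<Union>x\<in>B. exponents x"
    have "h \<in> A'" by (simp add: A'_def)
    have "h' \<in> B" by (simp add: B_def)
    have "Max ?E' = highest_exponent h"
      by (rule Max_UN_exponents[OF H(3,2) A'(1,2) \<open>h \<in> A'\<close> A'_h])
    moreover have Min_F: "Min ?F = lowest_exponent h'"
      by (rule Min_UN_exponents[OF H(3,2) B(1,2) \<open>h' \<in> B\<close> B_h])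
    moreover have "s \<le> lowest_exponent h'"
      using apart_le_exponent[OF H(3) h(1) h'(1) _ h'(2) lowest_exponent_mem] H(2) h h'
      by (simp add: C_def)
    then have "\<not> short halting_stage (Max ?E) (Min ?F)"
      using s unfolding short_def Min_F by blast
    moreover have "x < y" if "x \<in> A" "y \<in> B" for x y
      using A_h[OF that(1)] B_h[OF that(2)] h'(2) by simp
    moreover have "x < y" if "x \<in> A'" "y \<in> B" for x y
      using A'_h[OF that(1)] B_h[OF that(2)] h'(2) by simp
    ultimately show ?thesis
      using even_card_gaps_iff_short[OF H mono ab A B] even_card_gaps_iff_short[OF H mono ab A' B]
      by simp
  qed
  then show ?thesis by blast
qed

section \<open>Computing the halting set from H\<close>

theorem theorem5:
  "\<exists>c :: nat \<Rightarrow> nat. computable c \<and> (\<forall>n. c n \<in> {0, 1}) \<and>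
     (\<forall>H :: nat set. infinite H \<and> (\<forall>x\<in>H. 0 < x) \<and> apart H \<longrightarrow>
        (\<exists>a b :: nat. 0 < a \<and> 0 < b \<and> monochromatic c (FS {a, a + b, a + 2 * b, b} H)) \<longrightarrow>
        halting_set \<le>\<^sub>T H)"
proof (intro exI[of _ color] conjI allI impI)
  show "computable color" by (rule computable_color)
  show "color n \<in> {0, 1}" for n by (auto simp: color_def)
  fix H :: "nat set"
  assume H: "infinite H \<and> (\<forall>x\<in>H. 0 < x) \<and> apart H"
    and "\<exists>a b. 0 < a \<and> 0 < b \<and> monochromatic color (FS {a, a + b, a + 2 * b, b} H)"
  then obtain C where C: "\<And>h h'. h \<in> H \<Longrightarrow> h' \<in> H \<Longrightarrow> C \<le> h \<Longrightarrow> h < h' \<Longrightarrow>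
      \<not> short halting_stage (highest_exponent h) (lowest_exponent h')"
    using ex_not_short[of H] by metis
  \<comment> \<open>Unbounded search with oracle \<open>H\<close>; it terminates because
    \<open>H\<close> is infinite.\<close>
  define f where "f n = (LEAST k. k \<in> H \<and> n \<le> k)" for n
  have ex: "\<exists>k. k \<in> H \<and> n \<le> k" for n
    using H finite_nat_set_iff_bounded_le[of H] by (meson nat_le_linear)
  then have f: "f n \<in> H" "n \<le> f n" for n
    using LeastI_ex[OF ex] unfolding f_def by auto
  have computable_f: "computable_in H (\<lambda>n. f (g n))" if "computable_in H g" for g
    unfolding f_def using ex by (intro computable_intros computable_in_comp[OF _ that])
  \<comment> \<open>The summand \<open>C\<close> makes the gap after \<open>h x\<close> not short;
    the summand \<open>2 ^ x\<close> makes its lower end at least \<open>x\<close>.\<close>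
  define h where "h x = f (C + 2 ^ x)" for x
  define h' where "h' x = f (Suc (h x))" for x
  have "x \<in> halting_set \<longleftrightarrow> x \<in> halting_stage (h' x)" for x
  proof
    assume "x \<in> halting_stage (h' x)"
    then show "x \<in> halting_set" by (auto simp: halting_set_eq)
  next
    assume x: "x \<in> halting_set"
    have h: "h x \<in> H" "C + 2 ^ x \<le> h x" "h' x \<in> H" "h x < h' x"
      using f[of "C + 2 ^ x"] f[of "Suc (h x)"] by (auto simp: h_def h'_def)
    have "x \<le> highest_exponent (h x)"
      using h(2) by (intro le_highest_exponent) simp
    then have "x \<in> halting_stage (lowest_exponent (h' x))"
      using C[OF h(1,3) _ h(4)] h(2) x unfolding short_def halting_set_eq by auto
    \<comment> \<open>Passing to the later stage \<open>h' x\<close> avoids having to compute a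
      lowest exponent.\<close>
    moreover have "lowest_exponent (h' x) \<le> h' x"
      using exponents_less[OF lowest_exponent_mem[of "h' x"]] h(4) by simp
    ultimately show "x \<in> halting_stage (h' x)"
      using monoD[OF mono_halting_stage] by blast
  qed
  moreover have "decidable_in H (\<lambda>x. x \<in> halting_stage (h' x))"
    unfolding h'_def h_def by (intro computable_intros computable_f)
  ultimately show "halting_set \<le>\<^sub>T H"
    by (simp add: turing_reducible_def decidable_in_def)
qed

end
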